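(* For every integer $t \geq 2$, there is a graph $G_t$ of treewidth $t$ such that $\operatorname{diam}(\mathcal{I}(G_t)) \geq t+2$.
   Context: Graphs are finite and simple. In an orientation $\vec{G}$ of a graph $G$, the inversion of a set $X \subseteq V(G)$ consists in reversing all arcs with both endvertices in $X$. The inversion graph $\mathcal{I}(G)$ is the graph whose vertices are the labelled orientations of $G$, two orientations being adjacent if and only if the inversion of some $X\subseteq V(G)$ transforms one into the other; $\operatorname{diam}(\mathcal{I}(G))$ is its diameter. *)

theory Defs
  imports "Graph_Theory.Graph_Theory"
begin

text \<open>
  A finite simple graph is a \<^locale>\<open>pair_graph\<close>: an edge between \<open>u\<close> and \<open>v\<close> is the pair
  of arcs \<open>(u, v)\<close>, \<open>(v, u)\<close>. Orientations are values of the same record type that keep exactly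
  one arc of each such pair.
\<close>

section \<open>Treewidth\<close>

text \<open>
  The constant \<^const>\<open>tree\<close> of the library is about oriented trees: in a symmetric
  digraph it counts every edge, traversed back and forth, as a cycle. The cycles of a simple graph
  are those of length at least 3.
\<close>

definition simple_tree :: "'a pair_pre_digraph \<Rightarrow> bool" where
  "simple_tree T \<longleftrightarrow> pair_graph T \<and> strongly_connected (with_proj T) \<and>
     (\<nexists>p. pre_digraph.cycle (with_proj T) p \<and> 3 \<le> length p)"

definition tree_decomposition ::
    "'a pair_pre_digraph \<Rightarrow> 'i pair_pre_digraph \<Rightarrow> ('i \<Rightarrow> 'a set) \<Rightarrow> bool" where
  "tree_decomposition G T B \<longleftrightarrow>
     simple_tree T \<and>
     (\<Union>i\<in>pverts T. B i) = pverts G \<and>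
     (\<forall>(u, v)\<in>parcs G. \<exists>i\<in>pverts T. u \<in> B i \<and> v \<in> B i) \<and>
     (\<forall>v\<in>pverts G. strongly_connected (with_proj T \<restriction> {i \<in> pverts T. v \<in> B i}))"

text \<open>
  The subtraction is on naturals, so the graph without vertices gets width 0 rather than \<open>-1\<close>.
\<close>

definition decomposition_width :: "'i pair_pre_digraph \<Rightarrow> ('i \<Rightarrow> 'a set) \<Rightarrow> nat" where
  "decomposition_width T B = Max ((\<lambda>i. card (B i)) ` pverts T) - 1"

text \<open>Every finite tree has a copy on a set of natural numbers, so these index all decompositions.\<close>

definition treewidth :: "'a pair_pre_digraph \<Rightarrow> nat" where
  "treewidth G = (LEAST k. \<exists>(T :: nat pair_pre_digraph) B.
     tree_decomposition G T B \<and> decomposition_width T B = k)"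

section \<open>Orientations and inversions\<close>

definition orientations :: "'a pair_pre_digraph \<Rightarrow> 'a pair_pre_digraph set" where
  "orientations G = {D. pverts D = pverts G \<and> parcs D \<subseteq> parcs G \<and>
     (\<forall>(u, v)\<in>parcs G. (u, v) \<in> parcs D \<longleftrightarrow> (v, u) \<notin> parcs D)}"

definition inversion :: "'a set \<Rightarrow> 'a pair_pre_digraph \<Rightarrow> 'a pair_pre_digraph" where
  "inversion X D = \<lparr>pverts = pverts D,
     parcs = {(u, v). if u \<in> X \<and> v \<in> X then (v, u) \<in> parcs D else (u, v) \<in> parcs D}\<rparr>"

text \<open>
  The inversion graph is simple, so an inversion that changes nothing (such as that of the empty
  set) does not make an orientation adjacent to itself.
\<close>

definition inversion_graph :: "'a pair_pre_digraph \<Rightarrow> 'a pair_pre_digraph pair_pre_digraph" where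
  "inversion_graph G = \<lparr>pverts = orientations G,
     parcs = {(D, D'). D \<in> orientations G \<and> D' \<in> orientations G \<and> D \<noteq> D' \<and>
       (\<exists>X\<subseteq>pverts G. D' = inversion X D)}\<rparr>"

section \<open>Diameter\<close>

text \<open>With unit weights, \<^const>\<open>wf_digraph.\<mu>\<close> is the length of a shortest walk.\<close>

definition diameter :: "('a, 'b) pre_digraph \<Rightarrow> ereal" where
  "diameter G = (SUP u\<in>verts G. SUP v\<in>verts G. wf_digraph.\<mu> G (\<lambda>_. 1) u v)"

section \<open>The inversion graph is a finite simple graph\<close>

lemma inversion_inversion [simp]: "inversion X (inversion X D) = D"
  by (cases D) (auto simp: inversion_def)

lemma inversion_in_orientations:
  assumes "pair_graph G" and "D \<in> orientations G"
  shows "inversion X D \<in> orientations G"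
proof -
  interpret pair_graph G by fact
  from assms(2) show ?thesis
    unfolding orientations_def inversion_def
    by (auto split: if_splits dest: arcs_symmetric)
qed

lemma pair_graph_inversion_graph:
  assumes "pair_graph G"
  shows "pair_graph (inversion_graph G)"
proof -
  interpret pair_graph G by fact
  have "orientations G \<subseteq> (\<lambda>A. \<lparr>pverts = pverts G, parcs = A\<rparr>) ` Pow (parcs G)"
  proof
    fix D assume "D \<in> orientations G"
    then show "D \<in> (\<lambda>A. \<lparr>pverts = pverts G, parcs = A\<rparr>) ` Pow (parcs G)"
      by (cases D) (auto simp: orientations_def)
  qed
  then have fin: "finite (orientations G)"
    using pair_finite_arcs by (meson finite_Pow_iff finite_imageI finite_subset)
  have sub: "parcs (inversion_graph G) \<subseteq> orientations G \<times> orientations G"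
    by (auto simp: inversion_graph_def)
  have sym: "sym (parcs (inversion_graph G))"
    by (auto simp: inversion_graph_def sym_def)
  show ?thesis
  proof
    show "finite (parcs (inversion_graph G))"
      using sub fin by (meson finite_SigmaI finite_subset)
    show "symmetric (with_proj (inversion_graph G))"
      using sym by (simp add: symmetric_def)
  qed (use fin in \<open>auto simp: inversion_graph_def\<close>)
qed

end

theory Submission
  imports Defs "HOL-Library.Z2" "HOL-Library.Function_Algebras"
begin

text \<open>
  Two orientations are at distance at most \<open>k\<close> iff the vertices can be assigned vectors of
  \<open>F\<^sub>2\<^sup>k\<close> such that the arcs on which they differ are exactly those whose ends have inner
  product 1: the \<open>i\<close>-th coordinate of a vector says whether the vertex is in the \<open>i\<close>-th inverted set.
  So we need a graph of treewidth \<open>t\<close> and an edge labelling that is not realised by vectors in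
  dimension \<open>t + 1\<close>.

  Consider the game in which, from a \<open>t\<close>-clique with assigned vectors, an adversary attaches a new
  vertex with labels of its choice, the opponent assigns it a vector, and the adversary puts the
  new vertex in the place of one vertex of the clique. The \<open>t\<close>-tree in which all adversary moves
  are attached simultaneously shows that it suffices to win this game in dimension \<open>t + 1\<close>.
  A clique from which the opponent can go on has linearly independent vectors, so their orthogonal
  complement is \<open>{0, n}\<close> and the opponent has two options \<open>y\<close>, \<open>y + n\<close> for the new vertex. If \<open>n\<close> is
  isotropic, it lies in the span of the clique, and there are labels for which both options depend on
  fewer than \<open>t\<close> vectors of the clique, which produces a dependent clique. Otherwise the adversary
  can force a move to a clique with isotropic \<open>n\<close>. Three rounds suffice.
\<close>

section \<open>The game on vectors over the field with two elements\<close>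

text \<open>These simplification rules turn field arithmetic on \<^typ>\<open>bit\<close> into bit operations.\<close>

declare add_bit_eq_xor [simp del] mult_bit_eq_and [simp del] minus_bit_def [simp del]

definition bvecs :: "nat \<Rightarrow> (nat \<Rightarrow> bit) set" where
  "bvecs d = {v. \<forall>i\<ge>d. v i = 0}"

definition ip :: "nat \<Rightarrow> (nat \<Rightarrow> bit) \<Rightarrow> (nat \<Rightarrow> bit) \<Rightarrow> bit" where
  "ip d u v = (\<Sum>i<d. u i * v i)"

text \<open>For vectors in \<open>bvecs d\<close> this is linear independence of the
  \<open>K i\<close>, put as surjectivity of the evaluation map onto F_2^t, the form in which the
  game meets it.\<close>

definition all_labels :: "nat \<Rightarrow> nat \<Rightarrow> (nat \<Rightarrow> nat \<Rightarrow> bit) \<Rightarrow> bool" where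
  "all_labels d t K \<longleftrightarrow> (\<forall>l. \<exists>v\<in>bvecs d. \<forall>i<t. ip d v (K i) = l i)"

text \<open>The position \<open>j\<close> is quantified after \<open>v\<close>: the adversary sees
  the answer before choosing the clique vertex to replace.\<close>

fun survives :: "nat \<Rightarrow> nat \<Rightarrow> nat \<Rightarrow> (nat \<Rightarrow> nat \<Rightarrow> bit) \<Rightarrow> bool" where
  "survives d t 0 K \<longleftrightarrow> True"
| "survives d t (Suc r) K \<longleftrightarrow>
     (\<forall>l. \<exists>v\<in>bvecs d. (\<forall>i<t. ip d v (K i) = l i) \<and> (\<forall>j<t. survives d t r (K(j := v))))"

lemma finite_bvecs: "finite (bvecs d)"
  and card_bvecs: "card (bvecs d) = 2 ^ d"
proof -
  have "bij_betw (\<lambda>A i. of_bool (i \<in> A)) (Pow {..<d}) (bvecs d)"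
  proof (rule bij_betw_byWitness[where f' = "\<lambda>v. {i. v i = 1}"])
    show "\<forall>A\<in>Pow {..<d}. {i. of_bool (i \<in> A) = (1::bit)} = A"
      by auto
    show "\<forall>v\<in>bvecs d. (\<lambda>i. of_bool (i \<in> {i. v i = 1})) = v"
      by (auto simp: fun_eq_iff)
    show "(\<lambda>A i. of_bool (i \<in> A)) ` Pow {..<d} \<subseteq> bvecs d"
      by (auto simp: bvecs_def)
    show "(\<lambda>v. {i. v i = 1}) ` bvecs d \<subseteq> Pow {..<d}"
      by (force simp: bvecs_def not_le[symmetric])
  qed
  then show "finite (bvecs d)" "card (bvecs d) = 2 ^ d"
    by (auto simp: bij_betw_finite[symmetric] bij_betw_same_card[symmetric] card_Pow)
qed

lemma bvecs_zero [simp]: "0 \<in> bvecs d"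
  by (simp add: bvecs_def)

lemma bvecs_add: "u \<in> bvecs d \<Longrightarrow> v \<in> bvecs d \<Longrightarrow> u + v \<in> bvecs d"
  by (simp add: bvecs_def)

lemma bvecs_diff: "u \<in> bvecs d \<Longrightarrow> v \<in> bvecs d \<Longrightarrow> u - v \<in> bvecs d"
  by (simp add: bvecs_def)

lemma bvecs_sum: "(\<And>i. i \<in> A \<Longrightarrow> K i \<in> bvecs d) \<Longrightarrow> sum K A \<in> bvecs d"
  by (induction A rule: infinite_finite_induct) (auto intro: bvecs_add)

lemma ip_commute: "ip d u v = ip d v u"
  by (simp add: ip_def mult.commute)

lemma ip_zero [simp]: "ip d 0 v = 0" "ip d v 0 = 0"
  by (simp_all add: ip_def)

lemma ip_add: "ip d (u + v) w = ip d u w + ip d v w" "ip d w (u + v) = ip d w u + ip d w v"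
  by (simp_all add: ip_def sum.distrib distrib_left distrib_right)

lemma ip_diff: "ip d (u - v) w = ip d u w - ip d v w" "ip d w (u - v) = ip d w u - ip d w v"
  by (simp_all only: ip_def sum_subtractf left_diff_distrib right_diff_distrib minus_apply)

lemma ip_sum: "ip d v (sum K A) = (\<Sum>i\<in>A. ip d v (K i))"
  by (induction A rule: infinite_finite_induct)
     (simp_all only: sum.infinite sum.empty sum.insert ip_zero ip_add not_False_eq_True)

lemma ip_nonzero:
  assumes "v \<in> bvecs d" and "v \<noteq> 0"
  shows "\<exists>e\<in>bvecs d. ip d v e = 1"
proof -
  obtain i where i: "v i = 1"
    using assms(2) by (auto simp: fun_eq_iff)
  then have "i < d"
    using assms(1) by (force simp: bvecs_def not_le[symmetric])
  have "ip d v (\<lambda>j. of_bool (j = i)) = (\<Sum>j<d. if j = i then v j else 0)"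
    unfolding ip_def by (rule sum.cong) auto
  also have "\<dots> = 1"
    using i \<open>i < d\<close> by simp
  finally show ?thesis
    using \<open>i < d\<close> by (intro bexI[of _ "\<lambda>j. of_bool (j = i)"]) (auto simp: bvecs_def)
qed

section \<open>Linear independence and orthogonal complements\<close>

lemma all_labelsE:
  assumes "all_labels d t K"
  obtains v where "v \<in> bvecs d" "\<And>i. i < t \<Longrightarrow> ip d v (K i) = l i"
  using assms unfolding all_labels_def by blast

text \<open>Rank-nullity by counting: the \<open>2 ^ t\<close> fibres of the evaluation map are
  translates of the kernel and partition \<open>2 ^ Suc t\<close> vectors.\<close>

lemma kernel_of_all_labels:
  assumes "all_labels (Suc t) t K"
  obtains n where "n \<noteq> 0" "{v \<in> bvecs (Suc t). \<forall>i<t. ip (Suc t) v (K i) = 0} = {0, n}"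
proof -
  let ?V = "bvecs (Suc t)"
  define ker where "ker = {v \<in> ?V. \<forall>i<t. ip (Suc t) v (K i) = 0}"
  define \<phi> where "\<phi> v = {i. i < t \<and> ip (Suc t) v (K i) = 1}" for v
  have fiber: "card {v \<in> ?V. \<phi> v = A} = card ker" if "A \<in> Pow {..<t}" for A
  proof -
    obtain w where w: "w \<in> ?V" "\<And>i. i < t \<Longrightarrow> ip (Suc t) w (K i) = of_bool (i \<in> A)"
      using all_labelsE[OF assms, of "\<lambda>i. of_bool (i \<in> A)"] by blast
    have eq: "{v \<in> ?V. \<phi> v = A} = (\<lambda>v. v + w) ` ker"
    proof (intro equalityI subsetI)
      fix v assume v: "v \<in> {v \<in> ?V. \<phi> v = A}"
      have *: "ip (Suc t) v (K i) = ip (Suc t) w (K i)" if "i < t" for i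
        using v w that unfolding \<phi>_def by (cases "ip (Suc t) v (K i)") auto
      have "v - w \<in> ker"
        using * v w by (auto simp: ker_def ip_diff intro: bvecs_diff)
      then show "v \<in> (\<lambda>v. v + w) ` ker"
        by (metis diff_add_cancel image_eqI)
    next
      fix v assume "v \<in> (\<lambda>v. v + w) ` ker"
      then show "v \<in> {v \<in> ?V. \<phi> v = A}"
        using w that by (auto simp: ker_def \<phi>_def ip_add intro: bvecs_add split: if_splits)
    qed
    show ?thesis
      unfolding eq by (rule card_image) (auto simp: inj_on_def)
  qed
  have "card ?V = (\<Sum>A\<in>Pow {..<t}. \<Sum>v\<in>{v \<in> ?V. \<phi> v = A}. 1)"
    using sum.group[OF finite_bvecs, of "Pow {..<t}" \<phi> "Suc t" "\<lambda>_. 1::nat"]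
    by (force simp: \<phi>_def image_subset_iff)
  also have "\<dots> = 2 ^ t * card ker"
    using fiber by (simp add: card_Pow)
  finally have "card ker = 2"
    by (simp add: card_bvecs)
  then obtain a b where "ker = {a, b}" "a \<noteq> b"
    by (meson card_2_iff)
  moreover have "0 \<in> ker"
    by (simp add: ker_def)
  ultimately obtain n where "n \<noteq> 0" "ker = {0, n}"
    by (cases "a = 0") (auto simp: insert_commute)
  then show thesis
    using that by (simp add: ker_def)
qed

text \<open>A vector dual to \<open>K j\<close> reads off from a subset sum whether \<open>j\<close>
  occurs in it.\<close>

lemma inj_on_sum_of_all_labels:
  assumes "all_labels d t K"
  shows "inj_on (sum K) (Pow {..<t})"
proof -
  have sub: "A \<subseteq> B" if AB: "A \<subseteq> {..<t}" "B \<subseteq> {..<t}" and eq: "sum K A = sum K B" for A B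
  proof
    fix j assume "j \<in> A"
    obtain v where v: "\<And>i. i < t \<Longrightarrow> ip d v (K i) = of_bool (i = j)"
      using all_labelsE[OF assms, of "\<lambda>i. of_bool (i = j)"] by blast
    have fin: "finite A" "finite B"
      using AB finite_subset by auto
    have *: "ip d v (sum K C) = of_bool (j \<in> C)" if "C \<subseteq> {..<t}" "finite C" for C
    proof -
      have "ip d v (sum K C) = (\<Sum>i\<in>C. if i = j then 1 else 0)"
        unfolding ip_sum using v that by (intro sum.cong) auto
      then show ?thesis
        using that by simp
    qed
    show "j \<in> B"
      using *[OF AB(1) fin(1)] *[OF AB(2) fin(2)] eq \<open>j \<in> A\<close> by (auto split: if_splits)
  qed
  show ?thesis
    by (intro inj_onI subset_antisym) (simp_all add: sub)
qed

text \<open>The hyperplane orthogonal to \<open>n\<close> has at most \<open>2 ^ t\<close> elements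
  and contains the \<open>2 ^ t\<close> distinct subset sums, so it consists of them. An isotropic
  \<open>n\<close> lies in it.\<close>

lemma isotropic_kernel_in_span:
  assumes K: "\<forall>i<t. K i \<in> bvecs (Suc t)" and all: "all_labels (Suc t) t K"
    and n: "n \<in> bvecs (Suc t)" "n \<noteq> 0" "\<forall>i<t. ip (Suc t) n (K i) = 0"
    and iso: "ip (Suc t) n n = 0"
  obtains A where "A \<subseteq> {..<t}" "n = sum K A"
proof -
  let ?V = "bvecs (Suc t)"
  define P where "P = {v \<in> ?V. ip (Suc t) n v = 0}"
  have fin: "finite P"
    using finite_bvecs by (simp add: P_def)
  obtain e where e: "e \<in> ?V" "ip (Suc t) n e = 1"
    using ip_nonzero n by blast
  have "(\<lambda>v. v + e) ` P \<subseteq> ?V - P"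
    using e by (auto simp: P_def ip_add intro: bvecs_add)
  then have "card ((\<lambda>v. v + e) ` P) \<le> card (?V - P)"
    by (intro card_mono) (auto simp: finite_bvecs)
  also have "card ((\<lambda>v. v + e) ` P) = card P"
    by (rule card_image) (auto simp: inj_on_def)
  also have "card (?V - P) = 2 * 2 ^ t - card P"
    using fin by (subst card_Diff_subset) (auto simp: P_def card_bvecs)
  finally have "card P \<le> 2 ^ t"
    by simp
  moreover have "card (sum K ` Pow {..<t}) = 2 ^ t"
    using card_image[OF inj_on_sum_of_all_labels[OF all]] by (simp add: card_Pow)
  moreover have "sum K ` Pow {..<t} \<subseteq> P"
    using K n(3) by (fastforce simp: P_def ip_sum intro!: bvecs_sum sum.neutral)
  ultimately have "sum K ` Pow {..<t} = P"
    using fin by (intro card_seteq) auto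
  moreover have "n \<in> P"
    using n iso by (simp add: P_def)
  ultimately show thesis
    using that by auto
qed

lemma bit_fun_add_self [simp]: "v + v = (0 :: nat \<Rightarrow> bit)"
proof (rule ext)
  show "(v + v) i = 0 i" for i
    by (cases "v i") (simp_all only: plus_fun_apply zero_fun_apply add_0_left one_add_one bit_2_eq_0)
qed

section \<open>Losing positions of the game\<close>

lemma all_labels_if_survives:
  assumes "survives d t (Suc r) K"
  shows "all_labels d t K"
proof -
  have "\<exists>v\<in>bvecs d. \<forall>i<t. ip d v (K i) = l i" for l
    using assms[unfolded survives.simps, rule_format, of l] by (elim bexE conjE) (rule bexI)
  then show ?thesis
    unfolding all_labels_def by (rule allI)
qed

lemma not_all_labels_dependent:
  assumes "A \<subseteq> {..<t}" "j < t" "j \<notin> A"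
  shows "\<not> all_labels d t (K(j := sum K A))"
proof
  assume "all_labels d t (K(j := sum K A))"
  from inj_on_sum_of_all_labels[OF this] have "A = {j}"
  proof (rule inj_onD)
    have "sum (K(j := sum K A)) A = sum K A"
      using assms(3) by (intro sum.cong) auto
    then show "sum (K(j := sum K A)) A = sum (K(j := sum K A)) {j}"
      by simp
  qed (use assms in auto)
  then show False
    using assms(3) by simp
qed

text \<open>Asked for the labels of \<open>y\<close>, the opponent must answer \<open>y\<close> or
  \<open>n + y\<close>. Each is a subset sum omitting some index \<open>j\<close>; in place of
  \<open>K j\<close> it makes the clique dependent, which loses the next round.\<close>

lemma not_survives_isotropic:
  assumes t: "t \<ge> 2" and K: "\<forall>i<t. K i \<in> bvecs (Suc t)"
    and n: "n \<in> bvecs (Suc t)" "n \<noteq> 0" "\<forall>i<t. ip (Suc t) n (K i) = 0"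
    and iso: "ip (Suc t) n n = 0"
  shows "\<not> survives (Suc t) t (Suc (Suc r)) K"
proof
  assume surv: "survives (Suc t) t (Suc (Suc r)) K"
  then have all: "all_labels (Suc t) t K"
    by (rule all_labels_if_survives)
  obtain A where A: "A \<subseteq> {..<t}" "n = sum K A"
    using isotropic_kernel_in_span[OF K all n iso] .
  obtain n' where ker: "{v \<in> bvecs (Suc t). \<forall>i<t. ip (Suc t) v (K i) = 0} = {0, n'}"
    using kernel_of_all_labels[OF all] by blast
  with n have n': "n' = n"
    by blast
  \<comment> \<open>Both \<open>sum K B\<close> and \<open>n + sum K B\<close> omit some \<open>K j\<close>.\<close>
  define B where "B = (if A = {..<t} then {0} else {} :: nat set)"
  define y where "y = sum K B"
  have B: "B \<subseteq> {..<t}"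
    using t by (auto simp: B_def)
  obtain z where z: "z \<in> bvecs (Suc t)" "\<And>i. i < t \<Longrightarrow> ip (Suc t) z (K i) = ip (Suc t) y (K i)"
    and next_round: "\<And>j. j < t \<Longrightarrow> survives (Suc t) t (Suc r) (K(j := z))"
    using spec[OF surv[unfolded survives.simps(2)[of _ _ "Suc r"]], of "\<lambda>i. ip (Suc t) y (K i)"] by blast
  have "y \<in> bvecs (Suc t)"
    unfolding y_def using B K by (intro bvecs_sum) auto
  then have "z - y \<in> {v \<in> bvecs (Suc t). \<forall>i<t. ip (Suc t) v (K i) = 0}"
    using z by (auto simp: ip_diff intro: bvecs_diff)
  then have "z = y \<or> z = n + y"
    unfolding ker n' by (metis diff_add_cancel diff_eq_eq empty_iff insert_iff add.left_neutral)
  then have "\<exists>C j. C \<subseteq> {..<t} \<and> j < t \<and> j \<notin> C \<and> z = sum K C"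
  proof
    assume "z = y"
    moreover have "1 \<notin> B"
      by (simp add: B_def)
    ultimately show ?thesis
      unfolding y_def using t B by (intro exI[of _ B] exI[of _ 1]) auto
  next
    assume zn: "z = n + y"
    show ?thesis
    proof (cases "A = {..<t}")
      case True
      have "sum K {..<t} = K 0 + sum K ({..<t} - {0})"
        using t by (subst sum.remove[of _ 0]) auto
      then have "z = sum K ({..<t} - {0})"
        unfolding zn A(2) y_def B_def using True
        by (simp add: add.assoc[symmetric] add.commute[of _ "K 0"])
      then show ?thesis
        using t by (intro exI[of _ "{..<t} - {0}"] exI[of _ 0]) auto
    next
      case False
      then obtain j where "j < t" "j \<notin> A"
        using A(1) by auto
      then show ?thesis
        using False A by (auto simp: zn y_def B_def)
    qed
  qed
  then obtain C j where "C \<subseteq> {..<t}" "j < t" "j \<notin> C" "z = sum K C"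
    by blast
  then show False
    using not_all_labels_dependent[of C t j "Suc t" K] all_labels_if_survives[OF next_round, of j]
    by blast
qed

text \<open>Unless the complement is isotropic already, the first round serves to reach a clique
  where it is; two more rounds are lost there.\<close>

lemma not_survives:
  assumes t: "t \<ge> 2" and K: "\<forall>i<t. K i \<in> bvecs (Suc t)"
  shows "\<not> survives (Suc t) t 3 K"
proof
  assume "survives (Suc t) t 3 K"
  then have surv: "survives (Suc t) t (Suc (Suc (Suc 0))) K"
    by (simp add: numeral_3_eq_3)
  then have all: "all_labels (Suc t) t K"
    by (rule all_labels_if_survives)
  obtain n where "n \<noteq> 0"
    and ker: "{v \<in> bvecs (Suc t). \<forall>i<t. ip (Suc t) v (K i) = 0} = {0, n}"
    using kernel_of_all_labels[OF all] by blast
  then have n: "n \<in> bvecs (Suc t)" "n \<noteq> 0" "\<forall>i<t. ip (Suc t) n (K i) = 0"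
    by blast+
  have nn: "ip (Suc t) n n = 1"
    using not_survives_isotropic[OF t K n, of "Suc 0"] surv by (metis bit_not_zero_iff)
  obtain w0 where w0: "w0 \<in> bvecs (Suc t)" "\<And>i. i < t \<Longrightarrow> ip (Suc t) w0 (K i) = of_bool (i = 0)"
    using all_labelsE[OF all, of "\<lambda>i. of_bool (i = 0)"] by blast
  \<comment> \<open>\<open>w\<close> is orthogonal to \<open>n\<close> and to all vectors but \<open>K 0\<close>; depending on whether it is isotropic,
    \<open>w\<close> or \<open>w + n\<close> spans the orthogonal complement after \<open>K 0\<close> is replaced by \<open>n\<close> or \<open>K 0 + n\<close>.\<close>
  define w where "w = (if ip (Suc t) w0 n = 0 then w0 else w0 + n)"
  have w: "w \<in> bvecs (Suc t)" "\<And>i. i < t \<Longrightarrow> ip (Suc t) w (K i) = of_bool (i = 0)"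
    "ip (Suc t) w n = 0"
    using w0 n nn by (auto simp: w_def ip_add intro: bvecs_add)
  define B where "B = (if ip (Suc t) w w = 0 then {} else {0} :: nat set)"
  define y where "y = sum K B"
  have B: "B \<subseteq> {..<t}"
    using t by (auto simp: B_def)
  obtain z where z: "z \<in> bvecs (Suc t)" "\<And>i. i < t \<Longrightarrow> ip (Suc t) z (K i) = ip (Suc t) y (K i)"
    and next_round: "\<And>j. j < t \<Longrightarrow> survives (Suc t) t (Suc (Suc 0)) (K(j := z))"
    using spec[OF surv[unfolded survives.simps(2)[of _ _ "Suc (Suc 0)"]], of "\<lambda>i. ip (Suc t) y (K i)"] by blast
  have "y \<in> bvecs (Suc t)"
    unfolding y_def using B K by (intro bvecs_sum) auto
  then have "z - y \<in> {v \<in> bvecs (Suc t). \<forall>i<t. ip (Suc t) v (K i) = 0}"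
    using z by (auto simp: ip_diff intro: bvecs_diff)
  then have "z = y \<or> z = n + y"
    unfolding ker by (metis diff_add_cancel diff_eq_eq empty_iff insert_iff add.left_neutral)
  \<comment> \<open>The sum \<open>y\<close> omits index 1, so the answer \<open>y\<close> in place
    of \<open>K 1\<close> would give a dependent clique.\<close>
  moreover have "z \<noteq> y"
    using not_all_labels_dependent[OF B, of 1 "Suc t" K] t all_labels_if_survives[OF next_round, of 1]
    by (auto simp: y_def B_def)
  ultimately have zn: "z = n + y"
    by simp
  define n' where "n' = (if ip (Suc t) w w = 0 then w else w + n)"
  have nw: "ip (Suc t) n w = 0" and nK0: "ip (Suc t) n (K 0) = 0" "ip (Suc t) w (K 0) = 1"
    using w n t by (auto simp: ip_commute)
  show False
  proof (rule notE[OF not_survives_isotropic[OF t]])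
    show "survives (Suc t) t (Suc (Suc 0)) (K(0 := z))"
      using next_round t by auto
    show "n' \<in> bvecs (Suc t)"
      using w n by (auto simp: n'_def intro: bvecs_add)
    have "ip (Suc t) n' (K 0) = 1"
      using nK0 by (simp add: n'_def ip_add)
    then show "n' \<noteq> 0"
      by auto
    show "ip (Suc t) n' n' = 0"
      using nw w nn by (auto simp: n'_def ip_add)
    show "\<forall>i<t. ip (Suc t) n' ((K(0 := z)) i) = 0"
      using nw w nn n nK0 by (auto simp: n'_def ip_add zn y_def B_def)
    show "\<forall>i<t. (K(0 := z)) i \<in> bvecs (Suc t)"
      using K z by auto
  qed
qed

section \<open>Trees and cliques\<close>

text \<open>\<open>rtrancl_on S\<close> keeps walks inside \<open>S\<close>, so one relation serves
  for the whole tree and for all its subtrees.\<close>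

definition connected_on :: "'a set \<Rightarrow> 'a rel \<Rightarrow> bool" where
  "connected_on S r \<longleftrightarrow> S \<noteq> {} \<and> (\<forall>a\<in>S. \<forall>b\<in>S. (a, b) \<in> rtrancl_on S r)"

lemma connected_onD: "connected_on S r \<Longrightarrow> a \<in> S \<Longrightarrow> b \<in> S \<Longrightarrow> (a, b) \<in> rtrancl_on S r"
  by (simp add: connected_on_def)

lemma strongly_connected_with_proj:
  "strongly_connected (with_proj T) \<longleftrightarrow> connected_on (pverts T) (parcs T)"
  by (simp add: strongly_connected_def connected_on_def reachable_def)

lemma strongly_connected_induce_with_proj:
  "strongly_connected (with_proj T \<restriction> S) \<longleftrightarrow> connected_on S (parcs T)"
proof -
  have "arcs_ends (with_proj T \<restriction> S) = parcs T \<inter> S \<times> S"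
    by (auto simp: arcs_ends_conv induce_subgraph_def image_iff)
  moreover have "rtrancl_on S (parcs T \<inter> S \<times> S) = rtrancl_on S (parcs T)"
  proof (intro subset_antisym subrelI)
    fix a b assume "(a, b) \<in> rtrancl_on S (parcs T)"
    then show "(a, b) \<in> rtrancl_on S (parcs T \<inter> S \<times> S)"
    proof (induction rule: rtrancl_on_induct)
      case base
      then show ?case
        by (rule rtrancl_on_refl)
    next
      case (step y z)
      then have "(y, z) \<in> parcs T \<inter> S \<times> S"
        by simp
      with step.IH show ?case
        using step.hyps(4) by (rule rtrancl_on_into_rtrancl_on)
    qed
  qed (rule rtrancl_on_mono; blast)
  ultimately show ?thesis
    by (simp add: strongly_connected_def connected_on_def reachable_def)
qed

lemma connected_on_Diff_leaf:
  assumes conn: "connected_on S r" and "sym r" and "x \<in> S" "x \<noteq> l" "l \<noteq> p"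
    and leaf: "\<forall>q\<in>S. (l, q) \<in> r \<longrightarrow> q = p"
  shows "connected_on (S - {l}) r" and "l \<in> S \<Longrightarrow> p \<in> S"
proof -
  \<comment> \<open>A walk standing at \<open>l\<close> is recorded as standing at \<open>p\<close>,
    the only neighbour of \<open>l\<close> in \<open>S\<close>; this cuts out every detour through
    \<open>l\<close>.\<close>
  have main: "if b = l then (a, p) \<in> rtrancl_on (S - {l}) r else (a, b) \<in> rtrancl_on (S - {l}) r"
    if "(a, b) \<in> rtrancl_on S r" "a \<noteq> l" for a b
    using that
  proof (induction rule: rtrancl_on_induct)
    case (step y z)
    consider "y = l" "z = p" | "z = l" "y = p" | "y \<noteq> l" "z \<noteq> l"
      using step leaf \<open>sym r\<close> by (metis symE)
    then show ?case
      using step by cases (use \<open>l \<noteq> p\<close> in \<open>auto intro: rtrancl_on_into_rtrancl_on\<close>)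
  qed auto
  show "connected_on (S - {l}) r"
    unfolding connected_on_def
  proof (intro conjI ballI)
    show "S - {l} \<noteq> {}"
      using assms(3,4) by blast
    show "(a, b) \<in> rtrancl_on (S - {l}) r" if "a \<in> S - {l}" "b \<in> S - {l}" for a b
      using main[OF connected_onD[OF conn, of a b]] that by simp
  qed
  show "p \<in> S" if "l \<in> S"
    using main[OF connected_onD[OF conn \<open>x \<in> S\<close> that] \<open>x \<noteq> l\<close>] in_rtrancl_on_in_F(2)[of x p "S - {l}" r]
    by simp
qed

text \<open>
  A leaf \<open>l\<close> can be removed unless some \<open>v\<close> in the clique occurs in the bag of \<open>l\<close> only, and then
  that bag contains the whole clique.
\<close>

lemma clique_in_bag:
  assumes fin: "finite S" and "sym r"
    and leaf: "\<And>S'. S' \<subseteq> S \<Longrightarrow> connected_on S' r \<Longrightarrow> 2 \<le> card S' \<Longrightarrow>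
      \<exists>l\<in>S'. \<exists>p\<in>S'. l \<noteq> p \<and> (\<forall>q\<in>S'. (l, q) \<in> r \<longrightarrow> q = p)"
    and "connected_on S r"
    and "\<And>v. v \<in> C \<Longrightarrow> connected_on {i \<in> S. v \<in> B i} r"
    and "\<And>u v. u \<in> C \<Longrightarrow> v \<in> C \<Longrightarrow> \<exists>i\<in>S. u \<in> B i \<and> v \<in> B i"
  shows "\<exists>i\<in>S. C \<subseteq> B i"
  using fin leaf assms(4-)
proof (induction S rule: finite_psubset_induct)
  case (psubset S)
  show ?case
  proof (cases "2 \<le> card S")
    case False
    moreover have "S \<noteq> {}"
      using psubset.prems(2) by (simp add: connected_on_def)
    ultimately have "card S = 1"
      using psubset.hyps by (metis card_gt_0_iff less_2_cases not_le not_less_zero Suc_1 One_nat_def)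
    then obtain i where "S = {i}"
      by (auto simp: card_1_singleton_iff)
    then show ?thesis
      using psubset.prems(4) by blast
  next
    case True
    then obtain l p where l: "l \<in> S" "p \<in> S" "l \<noteq> p" "\<forall>q\<in>S. (l, q) \<in> r \<longrightarrow> q = p"
      using psubset.prems(1)[of S] psubset.prems(2) by auto
    show ?thesis
    proof (cases "\<exists>v\<in>C. {i \<in> S. v \<in> B i} \<subseteq> {l}")
      case True
      then have "C \<subseteq> B l"
        using psubset.prems(4) by blast
      then show ?thesis
        using l by blast
    next
      case False
      have conn: "connected_on ({i \<in> S. v \<in> B i} - {l}) r"
        and p: "v \<in> B l \<Longrightarrow> v \<in> B p" if v: "v \<in> C" for v
      proof -
        obtain x where "x \<in> {i \<in> S. v \<in> B i}" "x \<noteq> l"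
          using False v by blast
        note * = connected_on_Diff_leaf[OF psubset.prems(3)[OF v] \<open>sym r\<close> this l(3)]
        have "\<forall>q\<in>{i \<in> S. v \<in> B i}. (l, q) \<in> r \<longrightarrow> q = p"
          using l(4) by simp
        from *[OF this] show "connected_on ({i \<in> S. v \<in> B i} - {l}) r" "v \<in> B l \<Longrightarrow> v \<in> B p"
          using l(1) by simp_all
      qed
      have "\<exists>i\<in>S - {l}. C \<subseteq> B i"
      proof (rule psubset.IH)
        show "connected_on (S - {l}) r"
          using connected_on_Diff_leaf(1)[OF psubset.prems(2) \<open>sym r\<close> l(2) _ l(3)] l by auto
        show "connected_on {i \<in> S - {l}. v \<in> B i} r" if "v \<in> C" for v
        proof -
          have "{i \<in> S - {l}. v \<in> B i} = {i \<in> S. v \<in> B i} - {l}"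
            by blast
          then show ?thesis
            using conn[OF that] by simp
        qed
        \<comment> \<open>If \<open>u\<close> and \<open>v\<close> meet in the bag of
          \<open>l\<close>, they also meet in that of \<open>p\<close>.\<close>
        show "\<exists>i\<in>S - {l}. u \<in> B i \<and> v \<in> B i" if "u \<in> C" "v \<in> C" for u v
          using psubset.prems(4)[OF that] p that l(2,3) by blast
        show "\<exists>l\<in>S'. \<exists>p\<in>S'. l \<noteq> p \<and> (\<forall>q\<in>S'. (l, q) \<in> r \<longrightarrow> q = p)"
          if "S' \<subseteq> S - {l}" "connected_on S' r" "2 \<le> card S'" for S'
          using that psubset.prems(1)[of S'] by blast
      qed (use l in blast)
      then show ?thesis
        by blast
    qed
  qed
qed

text \<open>Take the first vertex \<open>u\<close> of a longest path in \<open>S\<close>. A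
  neighbour of \<open>u\<close> in \<open>S\<close> off the path would extend it; one on the path
  beyond the second vertex would close a cycle of length at least 3.\<close>

lemma (in pair_graph) ex_leaf:
  assumes S: "S \<subseteq> pverts G" "connected_on S (parcs G)" "2 \<le> card S"
    and no_cycle: "\<nexists>p. cycle p \<and> 3 \<le> length p"
  shows "\<exists>l\<in>S. \<exists>p\<in>S. l \<noteq> p \<and> (\<forall>q\<in>S. (l, q) \<in> parcs G \<longrightarrow> q = p)"
proof -
  define P where "P p \<longleftrightarrow> (\<exists>u v. apath u p v \<and> set (pawalk_verts u p) \<subseteq> S)" for p
  have bound: "length p < card (pverts G)" if "P p" for p
  proof -
    obtain u v where "apath u p v"
      using \<open>P p\<close> by (auto simp: P_def)
    then have "distinct (pawalk_verts u p)" "set (pawalk_verts u p) \<subseteq> pverts G"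
      by (auto simp: apath_def)
    then have "length (pawalk_verts u p) \<le> card (pverts G)"
      using distinct_card card_mono pair_finite_verts by metis
    then show ?thesis
      using length_awalk_verts[of u p] by simp
  qed
  obtain a b where ab: "a \<in> S" "b \<in> S" "a \<noteq> b"
    using S(3) by (meson card_2_iff' obtain_subset_with_card_n subset_iff card_le_Suc0_iff_eq)
  obtain c where c: "(a, c) \<in> parcs G" "c \<in> S"
  proof -
    have "(a, b) \<in> rtrancl_on S (parcs G)"
      using S(2) ab by (simp add: connected_on_def)
    then show thesis
      using ab(3) that by (cases rule: converse_rtrancl_on_cases) (auto dest: in_rtrancl_on_in_F)
  qed
  then have "P [(a, c)]"
    using ab S no_loops'[of a c] unfolding P_def
    by (intro exI[of _ a] exI[of _ c]) (auto simp: apath_simps)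
  then obtain p where p: "P p" and max: "\<And>q. P q \<Longrightarrow> length q \<le> length p"
    using ex_has_greatest_nat[of P "[(a, c)]" length "card (pverts G)"] bound by (metis less_imp_le)
  then have "p \<noteq> []"
    using \<open>P [(a, c)]\<close> by fastforce
  then obtain u w p' where pw: "p = (u, w) # p'"
    using p unfolding P_def by (cases p) auto
  obtain v where path: "apath u p v" and pS: "set (pawalk_verts u p) \<subseteq> S"
    using p pw unfolding P_def by (auto simp: apath_simps)
  have "q = w" if q: "q \<in> S" "(u, q) \<in> parcs G" for q
  proof (cases "q \<in> set (pawalk_verts u p)")
    case False
    then have "apath q ((q, u) # p) v"
      using path q arcs_symmetric by (auto simp: apath_Cons_iff)
    moreover have "set (pawalk_verts q ((q, u) # p)) \<subseteq> S"
      using pS q by auto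
    ultimately have "P ((q, u) # p)"
      unfolding P_def by blast
    then show ?thesis
      using max by fastforce
  next
    case True
    then obtain p1 p2 where split: "p = p1 @ p2" "awalk u p1 q" "awalk q p2 v"
      using awalk_decomp[of u p v q] path unfolding apath_def by blast
    then have path1: "apath u p1 q"
      using path by (auto simp: apath_append_iff)
    show ?thesis
    proof (cases "length p1 \<ge> 2")
      case True
      have "distinct (tl (pawalk_verts u p1) @ [u])"
        using path1 split(2) True unfolding apath_def
        by (cases p1) (auto simp: awalk_Cons_iff)
      moreover have "pawalk_verts u (p1 @ [(q, u)]) = pawalk_verts u p1 @ [u]"
        using split(2) by (auto simp: awalk_verts_append awalk_simps awalk_verts_conv)
      ultimately have "cycle (p1 @ [(q, u)])"
        using split(2) q arcs_symmetric in_arcsD1 unfolding cycle_def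
        by (intro exI[of _ u]) (auto simp: awalk_simps)
      then show ?thesis
        using True no_cycle by fastforce
    next
      case False
      moreover have "p1 \<noteq> []"
        using split(2) q no_loops' by (auto simp: awalk_Nil_iff)
      ultimately have "length p1 = Suc 0"
        by (simp add: Suc_leI le_antisym not_less_eq_eq numeral_2_eq_2)
      then have "p1 = [(u, w)]"
        using split(1) pw by (cases p1) auto
      then show ?thesis
        using split(2) by (auto simp: awalk_simps)
    qed
  qed
  moreover have "u \<in> S" "w \<in> S"
    using pS path pw hd_in_awalk_verts(2)[of w p' v] by (auto simp: apath_Cons_iff)
  moreover have "u \<noteq> w"
    using path pw by (auto simp: apath_simps dest: no_loops')
  ultimately show ?thesis
    by (intro bexI[of _ u] bexI[of _ w]) auto
qed

text \<open>Pairwise meeting subtrees of a tree have a common node, so some bag contains the clique.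
  \<open>Suc\<close> makes up for the subtraction in the width.\<close>

lemma card_clique_le_width:
  assumes dec: "tree_decomposition G T B" and G: "pair_graph G"
    and C: "C \<subseteq> pverts G" "\<And>u v. u \<in> C \<Longrightarrow> v \<in> C \<Longrightarrow> u \<noteq> v \<Longrightarrow> (u, v) \<in> parcs G"
  shows "card C \<le> Suc (decomposition_width T B)"
proof -
  have T: "pair_graph T" "connected_on (pverts T) (parcs T)"
    and no_cycle: "\<nexists>p. pre_digraph.cycle (with_proj T) p \<and> 3 \<le> length p"
    and cover: "(\<Union>i\<in>pverts T. B i) = pverts G"
    and arcs: "\<And>u v. (u, v) \<in> parcs G \<Longrightarrow> \<exists>i\<in>pverts T. u \<in> B i \<and> v \<in> B i"
    and conn: "\<And>v. v \<in> pverts G \<Longrightarrow> connected_on {i \<in> pverts T. v \<in> B i} (parcs T)"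
    using dec unfolding tree_decomposition_def simple_tree_def strongly_connected_with_proj
      strongly_connected_induce_with_proj by auto
  interpret T: pair_graph T by (fact T)
  interpret G: pair_graph G by (fact G)
  have "\<exists>i\<in>pverts T. C \<subseteq> B i"
  proof (rule clique_in_bag[OF T.pair_finite_verts _ _ T(2)])
    show "sym (parcs T)"
      using T.arcs_symmetric by (auto intro: symI)
    show "\<exists>l\<in>S. \<exists>p\<in>S. l \<noteq> p \<and> (\<forall>q\<in>S. (l, q) \<in> parcs T \<longrightarrow> q = p)"
      if "S \<subseteq> pverts T" "connected_on S (parcs T)" "2 \<le> card S" for S
      using T.ex_leaf[OF that no_cycle] .
    show "connected_on {i \<in> pverts T. v \<in> B i} (parcs T)" if "v \<in> C" for v
      using that C(1) conn by blast
    show "\<exists>i\<in>pverts T. u \<in> B i \<and> v \<in> B i" if "u \<in> C" "v \<in> C" for u v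
      using that C arcs cover by (cases "u = v") blast+
  qed
  then obtain i where i: "i \<in> pverts T" "C \<subseteq> B i"
    by blast
  then have "card C \<le> card (B i)"
    using cover by (intro card_mono) (auto intro: finite_subset[OF _ G.pair_finite_verts])
  also have "\<dots> \<le> Max ((\<lambda>i. card (B i)) ` pverts T)"
    using i T.pair_finite_verts by (intro Max_ge) auto
  finally show ?thesis
    by (simp add: decomposition_width_def)
qed

section \<open>Trees given by a parent map\<close>

lemma connected_on_rooted:
  assumes "apex \<in> S" and "sym r"
    and par: "\<And>v. v \<in> S \<Longrightarrow> v \<noteq> apex \<Longrightarrow> par v \<in> S \<and> (v, par v) \<in> r \<and> (rank (par v) :: nat) < rank v"
  shows "connected_on S r"
proof -
  have up: "(v, apex) \<in> rtrancl_on S r" if "v \<in> S" for v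
    using that
  proof (induction "rank v" arbitrary: v rule: less_induct)
    case less
    then show ?case
      using par[of v] \<open>apex \<in> S\<close>
      by (cases "v = apex") (auto intro: converse_rtrancl_on_into_rtrancl_on)
  qed
  then show ?thesis
    using \<open>apex \<in> S\<close> rtrancl_on_sym[OF \<open>sym r\<close>] unfolding connected_on_def
    by (meson empty_iff rtrancl_on_trans symE)
qed

lemma no_cycle_rooted:
  assumes arcs: "\<And>v w. (v, w) \<in> parcs T \<Longrightarrow>
      w = par v \<and> (rank (par v) :: nat) < rank v \<or> v = par w \<and> rank (par w) < rank w"
    and cyc: "pre_digraph.cycle (with_proj T) p" and len: "3 \<le> length p" and T: "pair_graph T"
  shows False
proof -
  interpret pair_graph T by (fact T)
  obtain u where u: "awalk u p u" "distinct (tl (pawalk_verts u p))" "p \<noteq> []"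
    using cyc unfolding cycle_def by blast
  have tl_verts: "tl (pawalk_verts u p) = map snd p"
    using u by (subst awalk_verts_conv'[of u p u]) auto
  \<comment> \<open>A cycle passes through its vertex \<open>m\<close> of maximal rank from \<open>par m\<close> to \<open>par m\<close>.\<close>
  have "finite (snd ` set p)" "snd ` set p \<noteq> {}"
    using u by auto
  then obtain m where m: "m \<in> snd ` set p" "\<And>x. x \<in> snd ` set p \<Longrightarrow> rank x \<le> rank m"
    using obtains_MAX[of "snd ` set p" rank] Max_ge[of "rank ` snd ` set p"] by (metis finite_imageI imageI)
  then obtain k p1 p2 where p: "p = p1 @ (k, m) # p2"
    by (metis imageE prod.collapse split_list)
  define q where "q = p2 @ p1"
  have walks: "awalk u p1 k" "(k, m) \<in> parcs T" "awalk m p2 u"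
    using u(1) p by (auto simp: awalk_simps)
  then have q: "awalk m q k"
    unfolding q_def by (rule_tac awalk_appendI)
  have len_q: "length q \<ge> 2"
    using len p by (simp add: q_def)
  have dist: "distinct (map snd (q @ [(k, m)]))"
    using u(2)[unfolded tl_verts, unfolded p] unfolding q_def by auto
  have set_p: "set p = insert (k, m) (set q)"
    using p by (auto simp: q_def)
  obtain e q' where eq': "q = e # q'"
    using len_q by (cases q) auto
  have fe: "fst e = m" "e \<in> parcs T" "awalk (snd e) q' k"
    using q eq' by (auto simp: awalk_simps)
  have "q' \<noteq> []"
    using len_q eq' by auto
  then have last: "snd (last q') = k" "last q' \<in> set q'"
    using fe(3) by (auto simp: awalk_verts_conv dest: awlast_of_awalk)
  have "snd e \<in> snd ` set p" "k \<in> snd ` set p"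
    using set_p eq' last by auto
  then have "rank (snd e) \<le> rank m" "rank k \<le> rank m"
    using m by auto
  then have "snd e = par m" "k = par m"
    using arcs[of m "snd e"] arcs[of k m] fe walks(2) by (metis prod.collapse not_le)+
  \<comment> \<open>As \<open>q'\<close> is nonempty, \<open>snd e\<close> and \<open>k\<close> are
    heads of arcs at different places of the cycle, yet both equal \<open>par m\<close>.\<close>
  then show False
    using dist eq' last by (auto simp: image_iff)
qed

section \<open>Inversions as vectors\<close>

lemma parcs_fold_inversion:
  "(a, b) \<in> parcs (fold inversion Xs D) \<longleftrightarrow>
    (if odd (length (filter (\<lambda>X. a \<in> X \<and> b \<in> X) Xs)) then (b, a) else (a, b)) \<in> parcs D"
  by (induction Xs arbitrary: D) (auto simp: inversion_def conj_commute)

lemma awalk_inversion_graph: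
  assumes "pair_graph G" and "pre_digraph.awalk (with_proj (inversion_graph G)) D p D'"
  shows "\<exists>Xs. length Xs = length p \<and> D' = fold inversion Xs D"
proof -
  interpret I: pair_graph "inversion_graph G"
    using assms(1) by (rule pair_graph_inversion_graph)
  show ?thesis
    using assms(2)
  proof (induction p arbitrary: D)
    case Nil
    then show ?case
      by (simp add: I.awalk_Nil_iff)
  next
    case (Cons e p)
    then obtain Xs where "length Xs = length p" "D' = fold inversion Xs (snd e)"
      by (auto simp: I.awalk_Cons_iff)
    moreover obtain X where "snd e = inversion X D"
    proof -
      have "(D, snd e) \<in> parcs (inversion_graph G)"
        using Cons.prems by (cases e) (auto simp: I.awalk_Cons_iff)
      then show ?thesis
        using that by (auto simp: inversion_graph_def)
    qed
    ultimately show ?case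
      by (intro exI[of _ "X # Xs"]) simp
  qed
qed

lemma of_nat_bit: "(of_nat n :: bit) = of_bool (odd n)"
  by (induction n) (auto simp: one_add_one)

text \<open>Coordinate \<open>i\<close> contributes 1 iff both vertices are in the
  \<open>i\<close>-th set. Padding with zeros covers walks shorter than \<open>d\<close>.\<close>

lemma ip_membership:
  assumes "length Xs \<le> d"
  shows "ip d (\<lambda>i. of_bool (i < length Xs \<and> a \<in> Xs ! i)) (\<lambda>i. of_bool (i < length Xs \<and> b \<in> Xs ! i)) =
    of_bool (odd (length (filter (\<lambda>X. a \<in> X \<and> b \<in> X) Xs)))"
proof -
  have "ip d (\<lambda>i. of_bool (i < length Xs \<and> a \<in> Xs ! i)) (\<lambda>i. of_bool (i < length Xs \<and> b \<in> Xs ! i)) =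
      (\<Sum>i<d. of_bool (i \<in> {i. i < length Xs \<and> a \<in> Xs ! i \<and> b \<in> Xs ! i}))"
    unfolding ip_def by (rule sum.cong) auto
  also have "\<dots> = (\<Sum>i\<in>{i. i < length Xs \<and> a \<in> Xs ! i \<and> b \<in> Xs ! i}. 1)"
    using assms by (intro sum.mono_neutral_cong_right) auto
  also have "\<dots> = of_nat (length (filter (\<lambda>X. a \<in> X \<and> b \<in> X) Xs))"
    by (simp add: length_filter_conv_card)
  finally show ?thesis
    by (simp add: of_nat_bit)
qed

text \<open>\<open>F\<close> prescribes the edges on which two orientations differ. If at most
  \<open>d\<close> inversions led from one to the other, the membership vectors would realise
  \<open>F\<close> in dimension \<open>d\<close>.\<close>

lemma diameter_inversion_graph_ge:
  fixes G :: "'a::linorder pair_pre_digraph"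
  assumes G: "pair_graph G" and "sym F"
    and no_vectors: "\<And>x :: 'a \<Rightarrow> nat \<Rightarrow> bit. (\<And>v. x v \<in> bvecs d) \<Longrightarrow>
      \<exists>(a, b)\<in>parcs G. ip d (x a) (x b) \<noteq> of_bool ((a, b) \<in> F)"
  shows "ereal (real (Suc d)) \<le> diameter (with_proj (inversion_graph G))"
proof -
  interpret G: pair_graph G by (fact G)
  interpret I: pair_graph "inversion_graph G"
    using G by (rule pair_graph_inversion_graph)
  \<comment> \<open>The linear order supplies a reference orientation; \<open>D'\<close> differs
    from it exactly on the edges in \<open>F\<close>.\<close>
  define D where "D = \<lparr>pverts = pverts G, parcs = {(a, b) \<in> parcs G. a < b}\<rparr>"
  define D' where "D' = \<lparr>pverts = pverts G, parcs = {(a, b) \<in> parcs G. (a < b) \<noteq> ((a, b) \<in> F)}\<rparr>"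
  have "D \<in> orientations G"
    using G.arcs_symmetric G.no_loops' by (fastforce simp: D_def orientations_def)
  moreover have "D' \<in> orientations G"
    unfolding orientations_def
  proof (intro CollectI conjI ballI, goal_cases)
    case (3 e)
    obtain a b where e: "e = (a, b)"
      by fastforce
    moreover have "(a, b) \<in> F \<longleftrightarrow> (b, a) \<in> F"
      using \<open>sym F\<close> by (auto dest: symD)
    ultimately show ?case
      using 3 G.arcs_symmetric[of a b] G.no_loops'[of a b] by (auto simp: D'_def)
  qed (auto simp: D'_def)
  moreover have "ereal (real (Suc d)) \<le> I.\<mu> (\<lambda>_. 1) D D'"
    unfolding I.\<mu>_def
  proof (rule INF_greatest)
    fix p assume "p \<in> {p. I.awalk D p D'}"
    then obtain Xs where Xs: "length Xs = length p" "D' = fold inversion Xs D"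
      using awalk_inversion_graph[OF G] by blast
    have "\<not> length p \<le> d"
    proof
      assume "length p \<le> d"
      define x where "x v = (\<lambda>i. of_bool (i < length Xs \<and> v \<in> Xs ! i) :: bit)" for v
      have "x v \<in> bvecs d" for v
        using \<open>length p \<le> d\<close> Xs(1) by (auto simp: x_def bvecs_def)
      then obtain a b where ab: "(a, b) \<in> parcs G" "ip d (x a) (x b) \<noteq> of_bool ((a, b) \<in> F)"
        using no_vectors by blast
      have "ip d (x a) (x b) = of_bool (odd (length (filter (\<lambda>X. a \<in> X \<and> b \<in> X) Xs)))"
        unfolding x_def using \<open>length p \<le> d\<close> Xs(1) by (intro ip_membership) simp
      moreover have "odd (length (filter (\<lambda>X. a \<in> X \<and> b \<in> X) Xs)) \<longleftrightarrow> (a, b) \<in> F"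
        using parcs_fold_inversion[of a b Xs D] ab(1) G.arcs_symmetric[of a b] G.no_loops'[of a b]
        unfolding Xs(2)[symmetric] by (auto simp: D_def D'_def split: if_splits)
      ultimately show False
        using ab(2) by simp
    qed
    moreover have "I.awalk_cost (\<lambda>_. 1) p = real (length p)"
      by (simp add: I.awalk_cost_def sum_list_triv)
    ultimately show "ereal (real (Suc d)) \<le> ereal (I.awalk_cost (\<lambda>_. 1) p)"
      by simp
  qed
  ultimately show ?thesis
    unfolding diameter_def with_proj_simps
    by (intro SUP_upper2[of D] SUP_upper2[of D']) (simp_all add: inversion_graph_def)
qed

section \<open>The graph of all plays\<close>

type_synonym history = "(nat \<times> bool list) list"

text \<open>At most three moves, to match the rounds of \<open>not_survives\<close>; the empty
  history precedes the first round. Labels are lists of booleans so that histories can be coded as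
  numbers.\<close>

definition histories :: "nat \<Rightarrow> history set" where
  "histories t = {h. set h \<subseteq> {..<t} \<times> {l. length l = t} \<and> length h \<le> 3}"

text \<open>
  A history lists, latest move first, the adversary's moves: the position \<open>j\<close> of the clique at which
  the previous vertex is inserted and the labels \<open>l\<close> of the next vertex. The vertex created by the
  history \<open>h\<close> is attached to the clique \<open>host t h\<close>; the empty history creates a first vertex, attached
  to the initial clique \<open>{..<t}\<close>.
\<close>

definition new_vertex :: "nat \<Rightarrow> history \<Rightarrow> nat" where
  "new_vertex t h = t + to_nat h"

fun host :: "nat \<Rightarrow> history \<Rightarrow> nat list" where
  "host t [] = [0..<t]"
| "host t ((j, l) # h) = (host t h)[j := new_vertex t h]"

definition bag :: "nat \<Rightarrow> history \<Rightarrow> nat set" where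
  "bag t h = insert (new_vertex t h) (set (host t h))"

text \<open>All pairs inside a bag are joined, so bags are cliques and cover the edges by
  construction.\<close>

definition game_graph :: "nat \<Rightarrow> nat pair_pre_digraph" where
  "game_graph t = \<lparr>pverts = (\<Union>h\<in>histories t. bag t h),
     parcs = {(a, b). a \<noteq> b \<and> (\<exists>h\<in>histories t. a \<in> bag t h \<and> b \<in> bag t h)}\<rparr>"

text \<open>The tree of plays, rooted at \<open>[]\<close>, where \<open>tl\<close> takes back the
  latest move. Nodes are coded as numbers because \<open>treewidth\<close> ranges over such
  trees.\<close>

definition game_tree :: "nat \<Rightarrow> nat pair_pre_digraph" where
  "game_tree t = \<lparr>pverts = to_nat ` histories t,
     parcs = (let E = (\<lambda>h. (to_nat h, to_nat (tl h))) ` (histories t - {[]}) in E \<union> E\<inverse>)\<rparr>"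

text \<open>The initial clique and the edges joining the first vertex to it get label 0. This choice
  is arbitrary, as \<open>not_survives\<close> allows any starting vectors.\<close>

definition game_labels :: "nat \<Rightarrow> nat rel" where
  "game_labels t = (let E = {(new_vertex t ((j, l) # h), host t ((j, l) # h) ! i) | j l h i. i < t \<and> l ! i}
     in E \<union> E\<inverse>)"

section \<open>Vertices, hosts and bags of the game graph\<close>

lemma finite_histories: "finite (histories t)"
proof -
  have "finite {l :: bool list. length l = t}"
    using finite_lists_length_eq[of "UNIV :: bool set" t] by simp
  then show ?thesis
    unfolding histories_def by (intro finite_lists_length_le) auto
qed

lemma Nil_in_histories [simp]: "[] \<in> histories t"
  by (simp add: histories_def)

lemma tl_in_histories: "h \<in> histories t \<Longrightarrow> tl h \<in> histories t"
  by (cases h) (auto simp: histories_def)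

lemma new_vertex_eq_iff [simp]: "new_vertex t h = new_vertex t h' \<longleftrightarrow> h = h'"
  by (simp add: new_vertex_def)

lemma length_host [simp]: "length (host t h) = t"
  by (induction h) auto

text \<open>Used to see that the vertex of \<open>h\<close> is new to its host: vertices created
  earlier in the play belong to proper suffixes of \<open>h\<close>.\<close>

lemma host_vertex_cases:
  assumes "a \<in> set (host t h)"
  obtains "a < t" | k where "0 < k" "k \<le> length h" "a = new_vertex t (drop k h)"
proof -
  have "a < t \<or> (\<exists>k>0. k \<le> length h \<and> a = new_vertex t (drop k h))"
    using assms
  proof (induction h)
    case (Cons s h)
    obtain j l where s: "s = (j, l)"
      by fastforce
    have "a = new_vertex t h \<or> a \<in> set (host t h)"
      using Cons.prems set_update_subset_insert[of "host t h" j "new_vertex t h"] by (auto simp: s)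
    then show ?case
    proof
      assume "a = new_vertex t h"
      then show ?thesis
        by (intro disjI2 exI[of _ 1]) simp
    next
      assume "a \<in> set (host t h)"
      then consider "a < t" | k where "k \<le> length h" "a = new_vertex t (drop k h)"
        using Cons.IH by blast
      then show ?thesis
      proof cases
        case (2 k)
        then show ?thesis
          by (intro disjI2 exI[of _ "Suc k"]) simp
      qed simp
    qed
  qed simp
  then show thesis
    using that by blast
qed

lemma new_vertex_in_host:
  assumes "new_vertex t h' \<in> set (host t h)"
  shows "length h' < length h"
  using assms by (cases rule: host_vertex_cases) (auto simp: new_vertex_def)

lemma distinct_host: "distinct (host t h)"
proof (induction h)
  case (Cons s h)
  then show ?case
    using new_vertex_in_host[of t h h] by (cases s) (auto intro: distinct_list_update)
qed simp

lemma card_bag: "card (bag t h) = Suc t"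
proof -
  have "new_vertex t h \<notin> set (host t h)"
    using new_vertex_in_host[of t h h] by blast
  then show ?thesis
    using distinct_card[OF distinct_host[of t h]] by (simp add: bag_def)
qed

lemma set_host_subset: "set (host t (s # h)) \<subseteq> bag t h"
  using set_update_subset_insert[of "host t h" "fst s" "new_vertex t h"] by (cases s) (simp add: bag_def)

section \<open>The game graph and its treewidth\<close>

lemma pair_graph_game_graph: "pair_graph (game_graph t)"
proof
  have "finite (\<Union>h\<in>histories t. bag t h)"
    using finite_histories by (simp add: bag_def)
  then show "finite (pverts (game_graph t))"
    by (simp add: game_graph_def)
  moreover have "parcs (game_graph t) \<subseteq> pverts (game_graph t) \<times> pverts (game_graph t)"
    by (auto simp: game_graph_def)
  ultimately show "finite (parcs (game_graph t))"
    by (meson finite_SigmaI finite_subset)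
  show "symmetric (with_proj (game_graph t))"
    by (auto simp: symmetric_def sym_def game_graph_def)
qed (auto simp: game_graph_def)

lemma pair_graph_game_tree: "pair_graph (game_tree t)"
proof
  show "fst e \<noteq> snd e" if e: "e \<in> parcs (game_tree t)" for e
  proof -
    obtain h :: history where h: "h \<noteq> []"
      and "e = (to_nat h, to_nat (tl h)) \<or> e = (to_nat (tl h), to_nat h)"
      using e by (auto simp: game_tree_def Let_def)
    moreover have "tl h \<noteq> h"
      using h by (cases h) simp_all
    ultimately show ?thesis
      by auto
  qed
  show "symmetric (with_proj (game_tree t))"
    by (auto simp: symmetric_def sym_def game_tree_def Let_def)
qed (use finite_histories in \<open>auto simp: game_tree_def Let_def dest: tl_in_histories\<close>)

text \<open>The bags containing a vertex \<open>a\<close> form a subtree with top \<open>h0\<close>,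
  the history that creates \<open>a\<close>, or \<open>[]\<close> for an initial vertex: in any
  other such bag \<open>a\<close> belongs to the host, hence also to the parent bag.\<close>

lemma tree_decomposition_game_graph:
  "tree_decomposition (game_graph t) (game_tree t) (\<lambda>i. bag t (from_nat i))"
proof -
  interpret T: pair_graph "game_tree t"
    by (rule pair_graph_game_tree)
  define par where "par i = to_nat (tl (from_nat i :: history))" for i
  define rank where "rank i = length (from_nat i :: history)" for i
  have sym: "sym (parcs (game_tree t))"
    using T.arcs_symmetric by (auto intro: symI)
  have conn: "connected_on S (parcs (game_tree t))"
    if "h0 \<in> H" and S: "S = to_nat ` H" and "H \<subseteq> histories t"
      and tl: "\<And>h. h \<in> H \<Longrightarrow> h \<noteq> h0 \<Longrightarrow> h \<noteq> [] \<and> tl h \<in> H" for h0 H S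
  proof (rule connected_on_rooted[OF _ sym])
    show "to_nat h0 \<in> S"
      using that by blast
    fix i assume "i \<in> S" "i \<noteq> to_nat h0"
    then obtain h where h: "i = to_nat h" "h \<in> H" "h \<noteq> [] \<and> tl h \<in> H"
      using S tl by blast
    then show "par i \<in> S \<and> (i, par i) \<in> parcs (game_tree t) \<and> rank (par i) < rank i"
      using that(3) by (auto simp: S par_def rank_def game_tree_def Let_def)
  qed
  have "simple_tree (game_tree t)"
    unfolding simple_tree_def strongly_connected_with_proj
  proof (intro conjI notI)
    show "connected_on (pverts (game_tree t)) (parcs (game_tree t))"
    proof (rule conn)
      show "h \<noteq> [] \<and> tl h \<in> histories t" if "h \<in> histories t" "h \<noteq> []" for h
        using that tl_in_histories by blast
    qed (auto simp: game_tree_def)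
    assume "\<exists>p. pre_digraph.cycle (with_proj (game_tree t)) p \<and> 3 \<le> length p"
    then obtain p where p: "pre_digraph.cycle (with_proj (game_tree t)) p" "3 \<le> length p"
      by blast
    show False
    proof (rule no_cycle_rooted[OF _ p pair_graph_game_tree])
      show "w = par v \<and> rank (par v) < rank v \<or> v = par w \<and> rank (par w) < rank w"
        if "(v, w) \<in> parcs (game_tree t)" for v w
        using that by (auto simp: par_def rank_def game_tree_def Let_def)
    qed
  qed (rule pair_graph_game_tree)
  moreover have "connected_on {i \<in> pverts (game_tree t). a \<in> bag t (from_nat i)} (parcs (game_tree t))"
    if a: "a \<in> pverts (game_graph t)" for a
  proof -
    define H where "H = {h \<in> histories t. a \<in> bag t h}"
    define h0 where "h0 = (if a < t then [] else from_nat (a - t) :: history)"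
    have step: "h \<noteq> [] \<and> tl h \<in> H" if "h \<in> H" "h \<noteq> h0" for h
    proof -
      have "a \<noteq> new_vertex t h"
        using that(2) by (auto simp: h0_def new_vertex_def)
      then have "a \<in> set (host t h)"
        using that(1) by (simp add: H_def bag_def)
      moreover from this have "h \<noteq> []"
        using that(2) by (auto simp: h0_def)
      ultimately have "a \<in> bag t (tl h)"
        using set_host_subset[of t "hd h" "tl h"] by auto
      then show ?thesis
        using that(1) \<open>h \<noteq> []\<close> tl_in_histories by (auto simp: H_def)
    qed
    have "h0 \<in> H" if "h \<in> H" for h
      using that
    proof (induction h)
      case Nil
      then show ?case
        using step[of "[]"] by auto
    next
      case (Cons s h)
      then show ?case
        using step[of "s # h"] by (cases "s # h = h0") auto
    qed
    moreover obtain h where "h \<in> H"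
      using a by (auto simp: H_def game_graph_def)
    ultimately have "connected_on (to_nat ` H) (parcs (game_tree t))"
      by (intro conn[of h0 H]) (use step in \<open>auto simp: H_def\<close>)
    moreover have "{i \<in> pverts (game_tree t). a \<in> bag t (from_nat i)} = to_nat ` H"
      by (auto simp: H_def game_tree_def)
    ultimately show ?thesis
      by simp
  qed
  ultimately show ?thesis
    unfolding tree_decomposition_def strongly_connected_induce_with_proj
    by (auto simp: game_graph_def game_tree_def)
qed

text \<open>The lower bound comes from the bag of \<open>[]\<close>, a clique on
  \<open>t + 1\<close> vertices.\<close>

lemma treewidth_game_graph: "treewidth (game_graph t) = t"
  unfolding treewidth_def
proof (rule Least_equality)
  have "histories t \<noteq> {}"
    using Nil_in_histories[of t] by blast
  then have "(\<lambda>i. card (bag t (from_nat i))) ` pverts (game_tree t) = {Suc t}"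
    by (auto simp: game_tree_def card_bag image_constant_conv)
  then have "decomposition_width (game_tree t) (\<lambda>i. bag t (from_nat i)) = t"
    by (simp add: decomposition_width_def)
  then show "\<exists>(T :: nat pair_pre_digraph) B.
      tree_decomposition (game_graph t) T B \<and> decomposition_width T B = t"
    using tree_decomposition_game_graph by blast
  fix k assume "\<exists>(T :: nat pair_pre_digraph) B.
      tree_decomposition (game_graph t) T B \<and> decomposition_width T B = k"
  then obtain T :: "nat pair_pre_digraph" and B
    where T: "tree_decomposition (game_graph t) T B" "decomposition_width T B = k"
    by blast
  have "card (bag t []) \<le> Suc k"
    unfolding T(2)[symmetric]
    using T(1) pair_graph_game_graph
  proof (rule card_clique_le_width)
    show "bag t [] \<subseteq> pverts (game_graph t)"
      using Nil_in_histories by (fastforce simp: game_graph_def)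
    show "(u, v) \<in> parcs (game_graph t)" if "u \<in> bag t []" "v \<in> bag t []" "u \<noteq> v" for u v
      using that Nil_in_histories by (fastforce simp: game_graph_def)
  qed
  then show "t \<le> k"
    by (simp add: card_bag)
qed

section \<open>Plays read off from vectors on the graph\<close>

text \<open>Distinctness of the host excludes a label from another position. A label from the
  reversed pair would put each vertex in the host of the other, so each history would be the shorter
  one.\<close>

lemma game_labels_iff:
  assumes "i < t"
  shows "(new_vertex t ((j, l) # h), host t ((j, l) # h) ! i) \<in> game_labels t \<longleftrightarrow> l ! i"
proof
  let ?s = "(j, l) # h"
  have in_host: "host t h' ! i' \<in> set (host t h')" if "i' < t" for h' i'
    using that by simp
  assume "(new_vertex t ?s, host t ?s ! i) \<in> game_labels t"
  then consider j' l' h' i' where "i' < t" "l' ! i'" "?s = (j', l') # h'" "host t ?s ! i = host t ((j', l') # h') ! i'"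
    | j' l' h' i' where "i' < t" "new_vertex t ?s = host t ((j', l') # h') ! i'" "host t ?s ! i = new_vertex t ((j', l') # h')"
    unfolding game_labels_def Let_def by (auto simp del: host.simps)
  then show "l ! i"
  proof cases
    case 1
    then show ?thesis
      using assms nth_eq_iff_index_eq[OF distinct_host[of t ?s], of i i'] by (simp del: host.simps)
  next
    case 2
    then have "length ?s < length ((j', l') # h')" "length ((j', l') # h') < length ?s"
      using in_host[OF 2(1), of "(j', l') # h'"] in_host[OF assms, of ?s]
      by (metis new_vertex_in_host)+
    then show ?thesis
      by simp
  qed
qed (use assms in \<open>auto simp: game_labels_def Let_def\<close>)

text \<open>The vectors form a strategy: to labels \<open>l\<close> the opponent answers with the
  vector of the vertex created by the play extended by \<open>(j, l)\<close>. The host of that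
  extension is the clique at hand.\<close>

lemma survives_game_graph:
  fixes x :: "nat \<Rightarrow> nat \<Rightarrow> bit"
  assumes x: "\<And>a. x a \<in> bvecs d"
    and ip_x: "\<And>a b. (a, b) \<in> parcs (game_graph t) \<Longrightarrow> ip d (x a) (x b) = of_bool ((a, b) \<in> game_labels t)"
    and "h \<in> histories t" "length h + r \<le> 3" "j < t"
  shows "survives d t r (\<lambda>i. x ((host t h)[j := new_vertex t h] ! i))"
  using assms(3-)
proof (induction r arbitrary: h j)
  case (Suc r)
  show ?case
    unfolding survives.simps
  proof
    fix l :: "nat \<Rightarrow> bit"
    define s where "s = (j, map (\<lambda>i. l i = 1) [0..<t]) # h"
    have host: "host t s = (host t h)[j := new_vertex t h]"
      by (simp add: s_def)
    have s: "s \<in> histories t"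
      using Suc.prems by (simp add: s_def histories_def)
    show "\<exists>v\<in>bvecs d. (\<forall>i<t. ip d v (x ((host t h)[j := new_vertex t h] ! i)) = l i) \<and>
        (\<forall>j'<t. survives d t r ((\<lambda>i. x ((host t h)[j := new_vertex t h] ! i))(j' := v)))"
    proof (intro bexI[OF _ x[of "new_vertex t s"]] conjI allI impI)
      fix i assume "i < t"
      have mem: "host t s ! i \<in> set (host t s)"
        using \<open>i < t\<close> by simp
      then have "new_vertex t s \<noteq> host t s ! i"
        using new_vertex_in_host[of t s s] by auto
      then have "(new_vertex t s, host t s ! i) \<in> parcs (game_graph t)"
        using s mem by (auto simp: game_graph_def bag_def)
      from ip_x[OF this] show "ip d (x (new_vertex t s)) (x ((host t h)[j := new_vertex t h] ! i)) = l i"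
        unfolding host[symmetric] using game_labels_iff[OF \<open>i < t\<close>, of j _ h] \<open>i < t\<close>
        by (simp add: s_def del: host.simps)
    next
      fix j' assume "j' < t"
      then have "survives d t r (\<lambda>i. x ((host t s)[j' := new_vertex t s] ! i))"
        using Suc.prems s by (intro Suc.IH) (auto simp: s_def)
      also have "(\<lambda>i. x ((host t s)[j' := new_vertex t s] ! i)) = (\<lambda>i. x (host t s ! i))(j' := x (new_vertex t s))"
        using \<open>j' < t\<close> by (auto simp: fun_eq_iff)
      finally show "survives d t r ((\<lambda>i. x ((host t h)[j := new_vertex t h] ! i))(j' := x (new_vertex t s)))"
        unfolding host .
    qed
  qed
qed simp

theorem theorem7p5:
  fixes t :: nat
  assumes "t \<ge> 2"
  shows "\<exists>G :: nat pair_pre_digraph.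
    pair_graph G \<and> treewidth G = t \<and>
    diameter (with_proj (inversion_graph G)) \<ge> ereal (real (t + 2))"
proof (intro exI conjI)
  \<comment> \<open>Refuting vectors in dimension \<open>t + 1\<close> excludes walks of length up
    to \<open>t + 1\<close>.\<close>
  have "ereal (real (Suc (Suc t))) \<le> diameter (with_proj (inversion_graph (game_graph t)))"
  proof (rule diameter_inversion_graph_ge[OF pair_graph_game_graph])
    show "sym (game_labels t)"
      by (auto simp: game_labels_def Let_def sym_def)
    fix x :: "nat \<Rightarrow> nat \<Rightarrow> bit"
    assume x: "\<And>v. x v \<in> bvecs (Suc t)"
    show "\<exists>(a, b)\<in>parcs (game_graph t). ip (Suc t) (x a) (x b) \<noteq> of_bool ((a, b) \<in> game_labels t)"
    proof (rule ccontr)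
      assume "\<not> ?thesis"
      then have "ip (Suc t) (x a) (x b) = of_bool ((a, b) \<in> game_labels t)"
        if "(a, b) \<in> parcs (game_graph t)" for a b
        using that by blast
      \<comment> \<open>The game starts with the vertex of \<open>[]\<close> in position 0, an
        arbitrary one, and three rounds ahead.\<close>
      from survives_game_graph[OF x this, of "[]" 3 0]
      have "survives (Suc t) t 3 (\<lambda>i. x ((host t [])[0 := new_vertex t []] ! i))"
        using assms by simp
      then show False
        using not_survives[OF assms, of "\<lambda>i. x ((host t [])[0 := new_vertex t []] ! i)"] x by simp
    qed
  qed
  then show "diameter (with_proj (inversion_graph (game_graph t))) \<ge> ereal (real (t + 2))"
    by simp
qed (rule pair_graph_game_graph treewidth_game_graph)+

end
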